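(* Let $(X,\mathsf a)$ be an action space. For $\tau,c>0$ let $\mathrm V(\tau,c):=\{(u_1,u_2)\in X\times X:\ \mathsf a(\tau,u_1,u_2)<c\}$. The family $$\mathfrak U:=\{\mathrm U\subset X\times X:\ \mathrm U\supset\mathrm V(\tau,c)\text{ for some }\tau,c>0\}$$ satisfies the axioms of a uniform structure on $X$, i.e. (1) if $\mathrm U\in\mathfrak U$ and $\mathrm U\subset\mathrm U'\subset X\times X$, then $\mathrm U'\in\mathfrak U$; (2) every finite intersection of elements of $\mathfrak U$ belongs to $\mathfrak U$; (3) every $\mathrm U\in\mathfrak U$ contains the diagonal $\{(u,u):u\in X\}$; (4) if $\mathrm U\in\mathfrak U$ then also $\mathrm U^{-1}\in\mathfrak U$; (5) if $\mathrm U\in\mathfrak U$ then there is $\mathrm V\in\mathfrak U$ such that $\mathrm V\circ\mathrm V\subset\mathrm U$.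
   Context: An action cost on a set $X$ is a function $\mathsf a:(0,+\infty)\times X\times X\to[0,+\infty)$ such that for all $\tau,\tau_1,\tau_2>0$ and $u_1,u_2,u_3\in X$: (i) $\mathsf a(\tau,u_1,u_2)=0$ if and only if $u_1=u_2$; (ii) $\mathsf a(\tau,u_1,u_2)=\mathsf a(\tau,u_2,u_1)$; (iii) $\mathsf a(\tau_1+\tau_2,u_1,u_3)\le \mathsf a(\tau_1,u_1,u_2)+\mathsf a(\tau_2,u_2,u_3)$. The pair $(X,\mathsf a)$ is called an action space. For subsets $\mathrm V,\mathrm V_1,\mathrm V_2$ of $X\times X$: $\mathrm V^{-1}:=\{(u_2,u_1):(u_1,u_2)\in\mathrm V\}$ and $\mathrm V_2\circ\mathrm V_1:=\{(u_1,u_3):\ \exists\,u_2\in X\text{ with }(u_1,u_2)\in\mathrm V_1,\ (u_2,u_3)\in\mathrm V_2\}$. *)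

theory Defs
  imports Complex_Main
begin

(* The cost is only constrained for positive times and points of X;
   its values elsewhere are irrelevant. *)
definition action_cost :: "'a set \<Rightarrow> (real \<Rightarrow> 'a \<Rightarrow> 'a \<Rightarrow> real) \<Rightarrow> bool" where
  "action_cost X a \<longleftrightarrow>
     (\<forall>\<tau>>0. \<forall>u\<in>X. \<forall>v\<in>X. 0 \<le> a \<tau> u v) \<and>
     (\<forall>\<tau>>0. \<forall>u\<in>X. \<forall>v\<in>X. a \<tau> u v = 0 \<longleftrightarrow> u = v) \<and>
     (\<forall>\<tau>>0. \<forall>u\<in>X. \<forall>v\<in>X. a \<tau> u v = a \<tau> v u) \<and>
     (\<forall>\<tau>\<^sub>1>0. \<forall>\<tau>\<^sub>2>0. \<forall>u\<in>X. \<forall>v\<in>X. \<forall>w\<in>X.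
        a (\<tau>\<^sub>1 + \<tau>\<^sub>2) u w \<le> a \<tau>\<^sub>1 u v + a \<tau>\<^sub>2 v w)"

definition action_sublevel ::
  "'a set \<Rightarrow> (real \<Rightarrow> 'a \<Rightarrow> 'a \<Rightarrow> real) \<Rightarrow> real \<Rightarrow> real \<Rightarrow> ('a \<times> 'a) set" where
  "action_sublevel X a \<tau> c = {(u, v). u \<in> X \<and> v \<in> X \<and> a \<tau> u v < c}"

definition action_entourages ::
  "'a set \<Rightarrow> (real \<Rightarrow> 'a \<Rightarrow> 'a \<Rightarrow> real) \<Rightarrow> ('a \<times> 'a) set set" where
  "action_entourages X a =
     {U. U \<subseteq> X \<times> X \<and> (\<exists>\<tau>>0. \<exists>c>0. action_sublevel X a \<tau> c \<subseteq> U)}"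

(* In the axiom on finite intersections, the intersection is taken inside X \<times> X,
   so that the empty intersection is X \<times> X; in particular the family is nonempty.
   Relation composition is written in diagrammatic order in HOL, i.e. the set
   V2 \<circ> V1 of pairs (u1, u3) with (u1, u2) in V1 and (u2, u3) in V2 is V1 O V2. *)
definition uniform_structure :: "'a set \<Rightarrow> ('a \<times> 'a) set set \<Rightarrow> bool" where
  "uniform_structure X \<UU> \<longleftrightarrow>
     \<UU> \<subseteq> Pow (X \<times> X) \<and>
     (\<forall>U\<in>\<UU>. \<forall>U'. U \<subseteq> U' \<and> U' \<subseteq> X \<times> X \<longrightarrow> U' \<in> \<UU>) \<and>
     (\<forall>\<F>. finite \<F> \<and> \<F> \<subseteq> \<UU> \<longrightarrow> (X \<times> X) \<inter> \<Inter>\<F> \<in> \<UU>) \<and>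
     (\<forall>U\<in>\<UU>. Id_on X \<subseteq> U) \<and>
     (\<forall>U\<in>\<UU>. U\<inverse> \<in> \<UU>) \<and>
     (\<forall>U\<in>\<UU>. \<exists>V\<in>\<UU>. V O V \<subseteq> U)"

end

theory Submission
  imports Defs
begin

text \<open>
  Everything rests on two consequences of the triangle inequality
  \<open>a (\<tau>\<^sub>1 + \<tau>\<^sub>2) u w \<le> a \<tau>\<^sub>1 u v + a \<tau>\<^sub>2 v w\<close>. Waiting at a point is free, so taking
  \<open>w = v\<close> shows that the cost is nonincreasing in time; hence the sublevels shrink when
  \<open>\<tau>\<close> and \<open>c\<close> decrease together, and any two of them contain a third one: they form a
  filter base (\<open>action_sublevel_mono\<close>, \<open>action_entourages_Int\<close>). Splitting both the time
  and the cost into halves, the same inequality provides a ``square root'' of an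
  entourage (\<open>action_sublevel_relcomp\<close>). Reflexivity and symmetry of the entourages are
  those of the cost.
\<close>

lemma action_cost_refl:
  assumes "action_cost X a" "0 < \<tau>" "u \<in> X"
  shows "a \<tau> u u = 0"
  using assms unfolding action_cost_def by blast

lemma action_cost_sym:
  assumes "action_cost X a" "0 < \<tau>" "u \<in> X" "v \<in> X"
  shows "a \<tau> u v = a \<tau> v u"
  using assms unfolding action_cost_def by blast

lemma action_cost_triangle:
  assumes "action_cost X a" "0 < \<sigma>" "0 < \<tau>" "u \<in> X" "v \<in> X" "w \<in> X"
  shows "a (\<sigma> + \<tau>) u w \<le> a \<sigma> u v + a \<tau> v w"
  using assms unfolding action_cost_def by blast

text \<open>Reach \<open>v\<close> in time \<open>\<sigma>\<close>, then stay there at no cost for the remaining time.\<close>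

lemma action_cost_antimono_time:
  assumes a: "action_cost X a" and "0 < \<sigma>" "\<sigma> \<le> \<tau>" and uv: "u \<in> X" "v \<in> X"
  shows "a \<tau> u v \<le> a \<sigma> u v"
proof (cases "\<sigma> = \<tau>")
  case False
  with \<open>\<sigma> \<le> \<tau>\<close> have pos: "0 < \<tau> - \<sigma>" by simp
  have "a (\<sigma> + (\<tau> - \<sigma>)) u v \<le> a \<sigma> u v + a (\<tau> - \<sigma>) v v"
    using action_cost_triangle[OF a \<open>0 < \<sigma>\<close> pos] uv by blast
  also have "a (\<tau> - \<sigma>) v v = 0"
    using action_cost_refl[OF a pos] uv by blast
  finally show ?thesis by simp
qed simp

lemma action_sublevel_mono:
  assumes a: "action_cost X a" and "0 < \<sigma>" "\<sigma> \<le> \<tau>" "b \<le> c"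
  shows "action_sublevel X a \<sigma> b \<subseteq> action_sublevel X a \<tau> c"
proof clarify
  fix u v assume "(u, v) \<in> action_sublevel X a \<sigma> b"
  then have uv: "u \<in> X" "v \<in> X" "a \<sigma> u v < b"
    by (simp_all add: action_sublevel_def)
  then have "a \<tau> u v < c"
    using action_cost_antimono_time[OF a \<open>0 < \<sigma>\<close> \<open>\<sigma> \<le> \<tau>\<close>, of u v] \<open>b \<le> c\<close> by linarith
  with uv show "(u, v) \<in> action_sublevel X a \<tau> c"
    by (simp add: action_sublevel_def)
qed

lemma Id_on_subset_action_sublevel:
  assumes "action_cost X a" "0 < \<tau>" "0 < c"
  shows "Id_on X \<subseteq> action_sublevel X a \<tau> c"
  using assms by (auto simp: action_sublevel_def action_cost_refl[OF assms(1)])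

lemma converse_action_sublevel:
  assumes "action_cost X a" "0 < \<tau>"
  shows "(action_sublevel X a \<tau> c)\<inverse> = action_sublevel X a \<tau> c"
proof -
  have "(u, v) \<in> (action_sublevel X a \<tau> c)\<inverse> \<longleftrightarrow> (u, v) \<in> action_sublevel X a \<tau> c" for u v
    using action_cost_sym[OF assms, of u v] by (auto simp: action_sublevel_def)
  then show ?thesis by auto
qed

lemma action_sublevel_relcomp:
  assumes a: "action_cost X a" and pos: "0 < \<sigma>" "0 < \<tau>"
  shows "action_sublevel X a \<sigma> b O action_sublevel X a \<tau> c
    \<subseteq> action_sublevel X a (\<sigma> + \<tau>) (b + c)"
proof clarify
  fix u v w
  assume "(u, v) \<in> action_sublevel X a \<sigma> b" "(v, w) \<in> action_sublevel X a \<tau> c"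
  then have uvw: "u \<in> X" "v \<in> X" "w \<in> X" "a \<sigma> u v < b" "a \<tau> v w < c"
    by (simp_all add: action_sublevel_def)
  then have "a (\<sigma> + \<tau>) u w < b + c"
    using action_cost_triangle[OF a pos, of u v w] by linarith
  with uvw show "(u, w) \<in> action_sublevel X a (\<sigma> + \<tau>) (b + c)"
    by (simp add: action_sublevel_def)
qed

lemma action_sublevel_in_entourages:
  assumes "0 < \<tau>" "0 < c"
  shows "action_sublevel X a \<tau> c \<in> action_entourages X a"
  using assms by (auto simp: action_entourages_def action_sublevel_def)

lemma action_entouragesE:
  assumes "U \<in> action_entourages X a"
  obtains \<tau> c where "U \<subseteq> X \<times> X" "0 < \<tau>" "0 < c" "action_sublevel X a \<tau> c \<subseteq> U"
  using assms by (auto simp: action_entourages_def)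

lemma action_entourages_mono:
  assumes "U \<in> action_entourages X a" "U \<subseteq> U'" "U' \<subseteq> X \<times> X"
  shows "U' \<in> action_entourages X a"
  using assms unfolding action_entourages_def by blast

lemma Times_in_action_entourages: "X \<times> X \<in> action_entourages X a"
  by (rule action_entourages_mono[OF action_sublevel_in_entourages[of 1 1]])
    (auto simp: action_sublevel_def)

lemma action_entourages_Int:
  assumes a: "action_cost X a"
    and U: "U \<in> action_entourages X a" and V: "V \<in> action_entourages X a"
  shows "U \<inter> V \<in> action_entourages X a"
proof -
  obtain \<sigma> b where U': "U \<subseteq> X \<times> X" "0 < \<sigma>" "0 < b" "action_sublevel X a \<sigma> b \<subseteq> U"
    using U by (rule action_entouragesE)
  obtain \<tau> c where V': "0 < \<tau>" "0 < c" "action_sublevel X a \<tau> c \<subseteq> V"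
    using V by (rule action_entouragesE)
  let ?W = "action_sublevel X a (min \<sigma> \<tau>) (min b c)"
  have "?W \<subseteq> action_sublevel X a \<sigma> b" "?W \<subseteq> action_sublevel X a \<tau> c"
    using U' V' by (simp_all add: action_sublevel_mono[OF a])
  then have "?W \<subseteq> U \<inter> V"
    using U' V' by blast
  moreover have "?W \<in> action_entourages X a"
    using U' V' by (simp add: action_sublevel_in_entourages)
  moreover have "U \<inter> V \<subseteq> X \<times> X"
    using U'(1) by blast
  ultimately show ?thesis
    using action_entourages_mono by metis
qed

lemma action_entourages_finite_Inter:
  assumes a: "action_cost X a" and "finite \<F>" "\<F> \<subseteq> action_entourages X a"
  shows "(X \<times> X) \<inter> \<Inter>\<F> \<in> action_entourages X a"
  using assms(2,3)
proof (induction \<F> rule: finite_induct)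
  case empty
  show ?case by (simp add: Times_in_action_entourages)
next
  case (insert U \<F>)
  then have "U \<inter> ((X \<times> X) \<inter> \<Inter>\<F>) \<in> action_entourages X a"
    by (simp add: action_entourages_Int[OF a] del: Int_iff)
  then show ?case by (simp add: Int_left_commute)
qed

lemma action_entourages_converse:
  assumes a: "action_cost X a" and U: "U \<in> action_entourages X a"
  shows "U\<inverse> \<in> action_entourages X a"
proof -
  obtain \<tau> c where U': "U \<subseteq> X \<times> X" "0 < \<tau>" "0 < c" "action_sublevel X a \<tau> c \<subseteq> U"
    using U by (rule action_entouragesE)
  have "action_sublevel X a \<tau> c \<subseteq> U\<inverse>"
    using U'(4) converse_mono[of "action_sublevel X a \<tau> c" U]
    by (simp add: converse_action_sublevel[OF a \<open>0 < \<tau>\<close>])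
  moreover have "U\<inverse> \<subseteq> X \<times> X"
    using U'(1) by blast
  ultimately show ?thesis
    by (rule action_entourages_mono[OF action_sublevel_in_entourages[OF U'(2,3)]])
qed

lemma action_entourages_square_root:
  assumes a: "action_cost X a" and U: "U \<in> action_entourages X a"
  shows "\<exists>V\<in>action_entourages X a. V O V \<subseteq> U"
proof -
  obtain \<tau> c where U': "0 < \<tau>" "0 < c" "action_sublevel X a \<tau> c \<subseteq> U"
    using U by (rule action_entouragesE)
  let ?V = "action_sublevel X a (\<tau> / 2) (c / 2)"
  have "?V O ?V \<subseteq> action_sublevel X a \<tau> c"
    using action_sublevel_relcomp[OF a, of "\<tau> / 2" "\<tau> / 2" "c / 2" "c / 2"] U' by simp
  with U' show ?thesis
    by (intro bexI[of _ ?V] action_sublevel_in_entourages) auto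
qed

theorem proposition3p3:
  fixes X :: "'a set" and a :: "real \<Rightarrow> 'a \<Rightarrow> 'a \<Rightarrow> real"
  assumes "action_cost X a"
  shows "uniform_structure X (action_entourages X a)"
  unfolding uniform_structure_def
proof (intro conjI ballI allI impI)
  show "action_entourages X a \<subseteq> Pow (X \<times> X)"
    by (auto simp: action_entourages_def)
next
  fix U U' assume "U \<in> action_entourages X a" "U \<subseteq> U' \<and> U' \<subseteq> X \<times> X"
  then show "U' \<in> action_entourages X a"
    by (auto intro: action_entourages_mono)
next
  fix \<F> assume "finite \<F> \<and> \<F> \<subseteq> action_entourages X a"
  then show "(X \<times> X) \<inter> \<Inter>\<F> \<in> action_entourages X a"
    by (simp add: action_entourages_finite_Inter[OF assms])
next
  fix U assume "U \<in> action_entourages X a"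
  then obtain \<tau> c where "0 < \<tau>" "0 < c" "action_sublevel X a \<tau> c \<subseteq> U"
    by (rule action_entouragesE)
  then show "Id_on X \<subseteq> U"
    using Id_on_subset_action_sublevel[OF assms] by (meson order_trans)
next
  fix U assume "U \<in> action_entourages X a"
  then show "U\<inverse> \<in> action_entourages X a"
    by (rule action_entourages_converse[OF assms])
next
  fix U assume "U \<in> action_entourages X a"
  then show "\<exists>V\<in>action_entourages X a. V O V \<subseteq> U"
    by (rule action_entourages_square_root[OF assms])
qed

end
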